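(* For a square matrix $A\in\mathbb{K}^{m\times m}$ and a matrix $X\in\mathbb{K}^{m\times p}$, let $R(A,X)=A-AX(X^*AX)^+(X^*A)$ be the generalized Wedderburn rank reduction of $A$ by $X=Y$. Then: (i) If $A$ is Hermitian positive semidefinite, then $R(A,X)$ is Hermitian positive semidefinite. Moreover, if $A^{1/2}$ is a Hermitian square root of $A$ and $B=A^{1/2}X$, then $R(A,X)=A^{1/2}\left(I-B(B^*B)^+B^*\right)A^{1/2}=A^{1/2}(I-BB^+)A^{1/2}$. (ii) If $A$ is skew-Hermitian, then $R(A,X)$ is skew-Hermitian. (iii) If $A$ is normal, then $R(A,X)$ in general does not need to be normal. For $$A=\frac{1}{\sqrt6}\begin{bmatrix}\sqrt3&0&\sqrt3\\-\sqrt2&\sqrt2&\sqrt2\\1&2&-1\end{bmatrix},\qquad X=\begin{bmatrix}1\\0\\1\end{bmatrix},$$ one has $$B=R(A,X)=\frac{1}{\sqrt6}\begin{bmatrix}-1&-2&1\\-\sqrt2&\sqrt2&\sqrt2\\1&2&-1\end{bmatrix}\quad\text{and}\quad [B,B^*]\neq0.$$ This example also shows that the generalized Wedderburn rank reduction by $X=Y$ of a matrix not diagonalizable over $\mathbb{R}$ in general does not need to be non-diagonalizable over $\mathbb{R}$. (iv) Similarly, if $A$ is a real matrix diagonalizable over $\mathbb{R}$, then $R(A,X)$ in general does not need to be diagonalizable over $\mathbb{R}$. (v) If $A$ is nilpotent, then $R(A,X)$ does not need to be nilpotent. For $$A=\begin{bmatrix}0&1&0&0\\0&0&1&0\\0&0&0&1\\0&0&0&0\end{bmatrix},\qquad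 X=\begin{bmatrix}1\\1\\1\\0\end{bmatrix},$$ the matrix $$R(A,X)=\frac12\begin{bmatrix}0&1&-1&-1\\0&-1&1&-1\\0&0&0&2\\0&0&0&0\end{bmatrix}$$ is not nilpotent. (vi) (Comment.) A version of the Sherman--Morrison--Woodbury formula for the pseudoinverse was proven by Deng; however, it seems unlikely that a concise formula for a reduction of a reduction exists.
   Context: $\mathbb{K}=\mathbb{R}$ or $\mathbb{K}=\mathbb{C}$; $M^*$ is the conjugate transpose and $M^+$ the Moore--Penrose pseudoinverse of a matrix $M$; $I$ is the identity matrix; $[M,N]=MN-NM$. For $A\in\mathbb{K}^{m\times n}$, $X\in\mathbb{K}^{n\times p}$, $Y\in\mathbb{K}^{m\times q}$, the generalized Wedderburn rank reduction of $A$ by $X,Y$ is $A-(AX)(Y^*AX)^+(Y^*A)$; here $A$ is square and $Y=X$. Over $\mathbb{R}$, Hermitian means symmetric and skew-Hermitian means skew-symmetric. A matrix $M$ is normal if $MM^*=M^*M$. *)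

theory Defs
  imports Complex_Main "Jordan_Normal_Form.Schur_Decomposition"
begin

text \<open>Matrices over \<^typ>\<open>real\<close> and \<^typ>\<open>complex\<close> are treated uniformly through the class
  \<^class>\<open>conjugatable_ordered_field\<close>: on \<^typ>\<open>real\<close>, \<^const>\<open>conjugate\<close> is the identity, so
  \<^const>\<open>mat_adjoint\<close> is the transpose.\<close>

definition hermitian_mat :: "'a :: conjugatable_field mat \<Rightarrow> bool" where
  "hermitian_mat M \<longleftrightarrow> mat_adjoint M = M"

definition skew_hermitian_mat :: "'a :: conjugatable_field mat \<Rightarrow> bool" where
  "skew_hermitian_mat M \<longleftrightarrow> mat_adjoint M = - M"

text \<open>Here \<open>(M *\<^sub>v v) \<bullet>c v\<close> is the scalar \<open>v\<^sup>* M v\<close>.  On \<^typ>\<open>complex\<close> the order is the one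
  of \<^theory>\<open>HOL-Library.Complex_Order\<close>, so \<open>0 \<le> z\<close> says that \<open>z\<close> is real and nonnegative.\<close>

definition psd_mat :: "'a :: conjugatable_ordered_field mat \<Rightarrow> bool" where
  "psd_mat M \<longleftrightarrow> hermitian_mat M \<and>
     (\<forall>v \<in> carrier_vec (dim_row M). 0 \<le> (M *\<^sub>v v) \<bullet>c v)"

definition normal_mat :: "'a :: conjugatable_field mat \<Rightarrow> bool" where
  "normal_mat M \<longleftrightarrow> M * mat_adjoint M = mat_adjoint M * M"

definition commutator_mat :: "'a :: ring mat \<Rightarrow> 'a mat \<Rightarrow> 'a mat" where
  "commutator_mat M N = M * N - N * M"

definition nilpotent_mat :: "'a :: semiring_1 mat \<Rightarrow> bool" where
  "nilpotent_mat M \<longleftrightarrow> square_mat M \<and> (\<exists>k. M ^\<^sub>m k = 0\<^sub>m (dim_row M) (dim_row M))"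

text \<open>Diagonalizability over the field of the entries: for a \<^typ>\<open>real mat\<close> this is
  diagonalizability over the reals.\<close>

definition diagonalizable_mat :: "'a :: semiring_1 mat \<Rightarrow> bool" where
  "diagonalizable_mat M \<longleftrightarrow> (\<exists>D. diagonal_mat D \<and> similar_mat M D)"

text \<open>The Moore--Penrose pseudoinverse, as the unique solution of the four Penrose equations.\<close>

definition is_pinv :: "'a :: conjugatable_field mat \<Rightarrow> 'a mat \<Rightarrow> bool" where
  "is_pinv M P \<longleftrightarrow> P \<in> carrier_mat (dim_col M) (dim_row M) \<and>
     M * P * M = M \<and> P * M * P = P \<and>
     hermitian_mat (M * P) \<and> hermitian_mat (P * M)"

definition pinv :: "'a :: conjugatable_field mat \<Rightarrow> 'a mat" where
  "pinv M = (THE P. is_pinv M P)"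

definition wedderburn_reduction ::
    "'a :: conjugatable_field mat \<Rightarrow> 'a mat \<Rightarrow> 'a mat \<Rightarrow> 'a mat" where
  "wedderburn_reduction A X Y =
     A - (A * X) * pinv (mat_adjoint Y * A * X) * (mat_adjoint Y * A)"

abbreviation wedderburn_R :: "'a :: conjugatable_field mat \<Rightarrow> 'a mat \<Rightarrow> 'a mat" where
  "wedderburn_R A X \<equiv> wedderburn_reduction A X X"

end

theory Submission
  imports Defs
begin

text \<open>Everything about \<open>R(A, X)\<close> for structured \<open>A\<close> follows from writing it as \<open>A - A C A\<close> with
  \<open>C = X (X\<^sup>* A X)\<^sup>+ X\<^sup>*\<close>.  The second Penrose equation gives \<open>C A C = C\<close>, and since the
  pseudoinverse commutes with the adjoint and with negation, \<open>C\<close> is Hermitian or skew-Hermitian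
  together with \<open>A\<close>.  In the skew-Hermitian case the claim is then immediate; in the semidefinite
  case \<open>C A C = C\<close> makes \<open>R(A, X)\<close> equal to the congruence \<open>(I - C A)\<^sup>* A (I - C A)\<close>.  If
  \<open>A = S S\<close> with \<open>S\<close> Hermitian and \<open>B = S X\<close>, then \<open>X\<^sup>* A X = B\<^sup>* B\<close>, so factoring \<open>S\<close> out on both
  sides gives \<open>R(A, X) = S (I - B (B\<^sup>* B)\<^sup>+ B\<^sup>*) S\<close>, and \<open>(B\<^sup>* B)\<^sup>+ B\<^sup>* = B\<^sup>+\<close> turns this
  into \<open>S (I - B B\<^sup>+) S\<close>.

  These arguments need the pseudoinverse to exist, so that the description by the Penrose equations
  denotes something.  It is constructed as \<open>M\<^sup>* G M\<^sup>*\<close> from an arbitrary generalized inverse \<open>G\<close>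
  of \<open>M\<^sup>* M M\<^sup>*\<close> (\<open>is_pinv_pinv\<close>), and generalized inverses are built column by column
  (\<open>generalized_inverse_columns\<close>).  All of this is done once for real and complex matrices.

  In the examples \<open>X\<close> is a single column and the pseudoinverse is the reciprocal of a scalar
  (\<open>wedderburn_R_column_index\<close>), which leaves entrywise computations; the complex versions are
  images of the real ones, because the pseudoinverse of a real matrix does not change when the
  matrix is read as a complex one.  Non-diagonalizability comes from two facts: a real orthogonal
  matrix that is diagonalizable over the reals is an involution
  (\<open>orthogonal_diagonalizable_involution\<close>), and a diagonalizable matrix with square zero is zero
  (\<open>diagonalizable_square_zero\<close>).\<close>

section \<open>Matrix algebra and adjoints\<close>

text \<open>With dimension equations as side conditions, in place of carrier memberships that mention
  intermediate dimensions, the simplifier can discharge them while rewriting.\<close>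

lemma mult_assoc_dim:
  fixes A :: "'a :: semiring_0 mat"
  assumes "dim_col A = dim_row B" and "dim_col B = dim_row C"
  shows "A * B * C = A * (B * C)"
  by (rule assoc_mult_mat[of A "dim_row A" "dim_row B" B "dim_row C" C "dim_col C"])
     (use assms in auto)

lemma minus_mult_distrib_dim:
  fixes A :: "'a :: ring mat"
  assumes "dim_row A = dim_row B" and "dim_col A = dim_col B" and "dim_col B = dim_row C"
  shows "(A - B) * C = A * C - B * C"
  by (rule minus_mult_distrib_mat[of A "dim_row A" "dim_row C" B C "dim_col C"])
     (use assms in auto)

lemma mult_minus_distrib_dim:
  fixes A :: "'a :: ring mat"
  assumes "dim_row B = dim_row C" and "dim_col B = dim_col C" and "dim_col A = dim_row C"
  shows "A * (B - C) = A * B - A * C"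
  by (rule mult_minus_distrib_mat[of A "dim_row A" "dim_row C" B "dim_col C" C])
     (use assms in auto)

lemma dim_mat_adjoint [simp]:
  "dim_row (mat_adjoint A) = dim_col A" "dim_col (mat_adjoint A) = dim_row A"
  by (simp_all add: mat_adjoint_def)

lemma index_mat_adjoint [simp]:
  assumes "i < dim_col A" "j < dim_row A"
  shows "mat_adjoint A $$ (i, j) = conjugate (A $$ (j, i))"
  using assms by (simp add: mat_adjoint_def mat_of_rows_index)

lemma mat_adjoint_adjoint [simp]: "mat_adjoint (mat_adjoint A) = A"
  by (rule eq_matI) auto

lemma mat_adjoint_mult:
  assumes "dim_col A = dim_row B"
  shows "mat_adjoint (A * B) = mat_adjoint B * mat_adjoint A"
proof (rule eq_matI)
  fix i j
  assume "i < dim_row (mat_adjoint B * mat_adjoint A)" "j < dim_col (mat_adjoint B * mat_adjoint A)"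
  with assms show "mat_adjoint (A * B) $$ (i, j) = (mat_adjoint B * mat_adjoint A) $$ (i, j)"
    by (auto simp: scalar_prod_def sum_conjugate conjugate_dist_mul mult.commute intro!: sum.cong)
qed (use assms in auto)

lemma mat_adjoint_minus:
  assumes "dim_row A = dim_row B" "dim_col A = dim_col B"
  shows "mat_adjoint (A - B) = mat_adjoint A - mat_adjoint B"
proof (rule eq_matI)
  fix i j
  assume "i < dim_row (mat_adjoint A - mat_adjoint B)" "j < dim_col (mat_adjoint A - mat_adjoint B)"
  moreover have "conjugate (a - b) = conjugate a - conjugate b" for a b :: 'a
    using conjugate_dist_add[of a "- b"] by (simp add: conjugate_neg)
  ultimately show "mat_adjoint (A - B) $$ (i, j) = (mat_adjoint A - mat_adjoint B) $$ (i, j)"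
    using assms by simp
qed (use assms in auto)

lemma mat_adjoint_one [simp]: "mat_adjoint (1\<^sub>m n :: 'a :: conjugatable_field mat) = 1\<^sub>m n"
proof -
  have "conjugate (1 :: 'a) * conjugate 1 = conjugate 1"
    using conjugate_dist_mul[of "1 :: 'a" 1] by simp
  then have "conjugate (1 :: 'a) = 1" by simp
  then show ?thesis by (intro eq_matI) auto
qed

lemma adjoint_mult_vec_cscalar_prod:
  fixes M :: "'a :: conjugatable_field mat"
  assumes w: "w \<in> carrier_vec (dim_row M)" and v: "v \<in> carrier_vec (dim_col M)"
  shows "(mat_adjoint M *\<^sub>v w) \<bullet>c v = w \<bullet>c (M *\<^sub>v v)"
proof -
  let ?f = "\<lambda>i j. conjugate (M $$ (j, i)) * w $ j * conjugate (v $ i)"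
  have "(mat_adjoint M *\<^sub>v w) \<bullet>c v = (\<Sum>i<dim_col M. \<Sum>j<dim_row M. ?f i j)"
    using w v by (auto simp: scalar_prod_def sum_distrib_right atLeast0LessThan intro!: sum.cong)
  also have "\<dots> = (\<Sum>j<dim_row M. \<Sum>i<dim_col M. ?f i j)"
    by (rule sum.swap)
  also have "\<dots> = w \<bullet>c (M *\<^sub>v v)"
    using w v by (auto simp: scalar_prod_def sum_distrib_left sum_conjugate conjugate_dist_mul
        atLeast0LessThan ac_simps intro!: sum.cong)
  finally show ?thesis .
qed

text \<open>The diagonal entries of \<open>N\<^sup>* N\<close> are the squared norms of the columns of \<open>N\<close>.  The
  cancellation rules derived from this are how definiteness of the inner product enters the theory
  of the pseudoinverse.\<close>

lemma adjoint_mult_self_eq_zero: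
  fixes N :: "'a :: conjugatable_ordered_field mat"
  assumes "mat_adjoint N * N = 0\<^sub>m (dim_col N) (dim_col N)"
  shows "N = 0\<^sub>m (dim_row N) (dim_col N)"
proof (rule eq_matI)
  fix i j
  assume "i < dim_row (0\<^sub>m (dim_row N) (dim_col N) :: 'a mat)"
    and "j < dim_col (0\<^sub>m (dim_row N) (dim_col N) :: 'a mat)"
  then have i: "i < dim_row N" and j: "j < dim_col N" by auto
  have "col N j \<bullet>c col N j = (mat_adjoint N * N) $$ (j, j)"
    using j by (auto simp: scalar_prod_def mult.commute intro!: sum.cong)
  also have "\<dots> = 0" using assms j by simp
  finally have "col N j = 0\<^sub>v (dim_row N)"
    using conjugate_square_eq_0_vec[of "col N j" "dim_row N"] j by auto
  then have "col N j $ i = 0" using i by simp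
  then show "N $$ (i, j) = 0\<^sub>m (dim_row N) (dim_col N) $$ (i, j)" using i j by simp
qed auto

lemma eq_mat_iff_minus_eq_zero:
  fixes A B :: "'a :: ring mat"
  assumes "dim_row A = dim_row B" "dim_col A = dim_col B"
  shows "A = B \<longleftrightarrow> A - B = 0\<^sub>m (dim_row B) (dim_col B)"
  using assms by (auto simp: mat_eq_iff)

lemma adjoint_mult_cancel_left:
  fixes M :: "'a :: conjugatable_ordered_field mat"
  assumes d: "dim_row Y = dim_col M" "dim_row Z = dim_col M" "dim_col Y = dim_col Z"
    and eq: "mat_adjoint M * (M * Y) = mat_adjoint M * (M * Z)"
  shows "M * Y = M * Z"
proof -
  let ?N = "M * (Y - Z)"
  have "mat_adjoint ?N * ?N
      = mat_adjoint (Y - Z) * (mat_adjoint M * (M * Y) - mat_adjoint M * (M * Z))"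
    using d by (simp add: mat_adjoint_mult mult_assoc_dim) (simp add: mult_minus_distrib_dim)
  also have "\<dots> = 0\<^sub>m (dim_col ?N) (dim_col ?N)"
    unfolding eq using d
    by (subst minus_r_inv_mat[of _ "dim_col M" "dim_col Z"])
       (auto intro!: carrier_matI right_mult_zero_mat)
  finally have "?N = 0\<^sub>m (dim_row ?N) (dim_col ?N)" by (rule adjoint_mult_self_eq_zero)
  then show ?thesis
    using d eq_mat_iff_minus_eq_zero[of "M * Y" "M * Z"] by (simp add: mult_minus_distrib_dim)
qed

lemma adjoint_mult_cancel_right:
  fixes M :: "'a :: conjugatable_ordered_field mat"
  assumes d: "dim_col Y = dim_row M" "dim_col Z = dim_row M" "dim_row Y = dim_row Z"
    and eq: "Y * M * mat_adjoint M = Z * M * mat_adjoint M"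
  shows "Y * M = Z * M"
proof -
  from eq have "mat_adjoint (Y * M * mat_adjoint M) = mat_adjoint (Z * M * mat_adjoint M)"
    by simp
  then have "mat_adjoint (mat_adjoint M) * (mat_adjoint M * mat_adjoint Y)
      = mat_adjoint (mat_adjoint M) * (mat_adjoint M * mat_adjoint Z)"
    using d by (simp add: mat_adjoint_mult)
  then have "mat_adjoint M * mat_adjoint Y = mat_adjoint M * mat_adjoint Z"
    using adjoint_mult_cancel_left[of "mat_adjoint Y" "mat_adjoint M" "mat_adjoint Z"] d by simp
  then have "mat_adjoint (mat_adjoint M * mat_adjoint Y) = mat_adjoint (mat_adjoint M * mat_adjoint Z)"
    by simp
  then show ?thesis using d by (simp add: mat_adjoint_mult)
qed

section \<open>Existence and uniqueness of the Moore--Penrose pseudoinverse\<close>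

text \<open>Over any field a generalized inverse can be built one column at a time.  If \<open>G\<close> already
  reproduces the first \<open>k\<close> columns of \<open>A\<close> and \<open>c\<close> is the next one, let \<open>u = c - A G c\<close>.  Either
  \<open>u = 0\<close>, or some coordinate form \<open>w\<close> has \<open>w u = 1\<close>; then \<open>r = w (I - A G)\<close> kills the first
  \<open>k\<close> columns and maps \<open>c\<close> to \<open>1\<close>, so that \<open>G + (e - G c) r\<close>, with \<open>e\<close> the unit vector
  number \<open>k\<close>, works for all \<open>k + 1\<close> columns.\<close>

lemma generalized_inverse_columns:
  fixes A :: "'a :: field mat"
  assumes A: "A \<in> carrier_mat m n"
  shows "k \<le> n \<Longrightarrow> \<exists>G \<in> carrier_mat n m. \<forall>j<k. A *\<^sub>v (G *\<^sub>v col A j) = col A j"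
proof (induction k)
  case 0
  show ?case by (intro bexI[of _ "0\<^sub>m n m"]) auto
next
  case (Suc k)
  then obtain G where G: "G \<in> carrier_mat n m"
    and IH: "\<And>j. j < k \<Longrightarrow> A *\<^sub>v (G *\<^sub>v col A j) = col A j" by auto
  have k: "k < n" using Suc.prems by simp
  define c where "c = col A k"
  define u where "u = c - A *\<^sub>v (G *\<^sub>v c)"
  have c: "c \<in> carrier_vec m" using A by (auto simp: c_def)
  have u: "u \<in> carrier_vec m" using A c by (intro carrier_vecI) (auto simp: u_def)
  show ?case
  proof (cases "u = 0\<^sub>v m")
    case True
    have "A *\<^sub>v (G *\<^sub>v c) = c"
    proof (rule eq_vecI)
      fix i assume i: "i < dim_vec c"
      then have "u $ i = 0" using True c by simp
      then show "(A *\<^sub>v (G *\<^sub>v c)) $ i = c $ i" using i A c by (simp add: u_def)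
    qed (use A c in auto)
    then show ?thesis using G IH by (intro bexI[of _ G]) (auto simp: less_Suc_eq c_def)
  next
    case False
    then obtain l where l: "l < m" and ul: "u $ l \<noteq> 0"
      using u by (auto simp: vec_eq_iff)
    define r where "r x = (x - A *\<^sub>v (G *\<^sub>v x)) $ l / u $ l" for x
    define p where "p = unit_vec n k - G *\<^sub>v c"
    have p: "p \<in> carrier_vec n" using G c by (intro carrier_vecI) (auto simp: p_def)
    have Ae: "A *\<^sub>v unit_vec n k = c"
      using A k by (intro eq_vecI) (auto simp: c_def)
    have Ap: "A *\<^sub>v p = u"
      using A G c mult_minus_distrib_mat_vec[OF A, of "unit_vec n k" "G *\<^sub>v c"]
      by (simp add: p_def u_def Ae)
    define W where "W = 1\<^sub>m m - A * G"
    have W: "W \<in> carrier_mat m m" using A G by (intro carrier_matI) (auto simp: W_def)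
    have rW: "r x = row W l \<bullet> x / u $ l" if "x \<in> carrier_vec m" for x
    proof -
      have "W *\<^sub>v x = x - A *\<^sub>v (G *\<^sub>v x)"
        using A G that minus_mult_distrib_mat_vec[of "1\<^sub>m m" m m "A * G" x] by (simp add: W_def)
      then show ?thesis using l W by (simp add: r_def flip: index_mult_mat_vec)
    qed
    define H where "H = G + mat n m (\<lambda>(i, j). p $ i * (row W l $ j / u $ l))"
    have H: "H \<in> carrier_mat n m" using G by (simp add: H_def)
    have Hx: "H *\<^sub>v x = G *\<^sub>v x + r x \<cdot>\<^sub>v p" if x: "x \<in> carrier_vec m" for x
    proof (rule eq_vecI)
      fix i assume "i < dim_vec (G *\<^sub>v x + r x \<cdot>\<^sub>v p)"
      then have i: "i < n" using p by simp
      have "(H *\<^sub>v x) $ i = (\<Sum>j<m. (G $$ (i, j) + p $ i * (row W l $ j / u $ l)) * x $ j)"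
        using i G x by (auto simp: H_def scalar_prod_def atLeast0LessThan intro!: sum.cong)
      also have "\<dots> = (\<Sum>j<m. G $$ (i, j) * x $ j) + p $ i * ((\<Sum>j<m. row W l $ j * x $ j) / u $ l)"
        by (simp add: sum.distrib sum_distrib_left sum_divide_distrib algebra_simps)
      also have "\<dots> = (G *\<^sub>v x + r x \<cdot>\<^sub>v p) $ i"
        using i G x p W l by (simp add: rW scalar_prod_def atLeast0LessThan)
      finally show "(H *\<^sub>v x) $ i = (G *\<^sub>v x + r x \<cdot>\<^sub>v p) $ i" .
    qed (use G H p in auto)
    have AHx: "A *\<^sub>v (H *\<^sub>v x) = A *\<^sub>v (G *\<^sub>v x) + r x \<cdot>\<^sub>v u" if x: "x \<in> carrier_vec m" for x
      using x A G p by (simp add: Hx Ap mult_add_distrib_mat_vec[OF A] mult_mat_vec[OF A])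
    have "A *\<^sub>v (H *\<^sub>v col A j) = col A j" if "j < Suc k" for j
    proof (cases "j = k")
      case True
      have "r c = 1" using ul by (simp add: r_def flip: u_def)
      then have "A *\<^sub>v (H *\<^sub>v c) = A *\<^sub>v (G *\<^sub>v c) + u" using AHx[OF c] by simp
      also have "\<dots> = c" using A c by (auto simp: u_def)
      finally show ?thesis using True by (simp add: c_def)
    next
      case False
      with that have j: "j < k" by simp
      have cj: "col A j \<in> carrier_vec m" using A by auto
      have "r (col A j) = 0" using IH[OF j] A l by (simp add: r_def)
      moreover have "0 \<cdot>\<^sub>v u = 0\<^sub>v m" using u by (intro eq_vecI) auto
      ultimately show ?thesis using AHx[OF cj] IH[OF j] right_zero_vec[OF cj] by simp
    qed
    then show ?thesis using H by blast
  qed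
qed

lemma generalized_inverse_exists:
  fixes A :: "'a :: field mat"
  shows "\<exists>G \<in> carrier_mat (dim_col A) (dim_row A). A * G * A = A"
proof -
  obtain G where G: "G \<in> carrier_mat (dim_col A) (dim_row A)"
    and GA: "\<And>j. j < dim_col A \<Longrightarrow> A *\<^sub>v (G *\<^sub>v col A j) = col A j"
    using generalized_inverse_columns[of A "dim_row A" "dim_col A" "dim_col A"] by auto
  have "A * G * A = A"
  proof (rule eq_matI)
    fix i j assume i: "i < dim_row A" and j: "j < dim_col A"
    have "(A * (G * A)) $$ (i, j) = (A *\<^sub>v (G *\<^sub>v col A j)) $ i"
      using i j G by (auto simp: scalar_prod_def intro!: sum.cong)
    then show "(A * G * A) $$ (i, j) = A $$ (i, j)"
      using i j G GA[OF j] by (simp add: mult_assoc_dim)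
  qed (use G in auto)
  then show ?thesis using G by blast
qed

lemma is_pinvD:
  assumes "is_pinv M P"
  shows "dim_row P = dim_col M" "dim_col P = dim_row M" "M * (P * M) = M" "P * (M * P) = P"
    "mat_adjoint P * mat_adjoint M = M * P" "mat_adjoint M * mat_adjoint P = P * M"
proof -
  show d: "dim_row P = dim_col M" "dim_col P = dim_row M"
    using assms by (auto simp: is_pinv_def)
  show "M * (P * M) = M" "P * (M * P) = P"
    using assms d by (simp_all add: is_pinv_def mult_assoc_dim)
  show "mat_adjoint P * mat_adjoint M = M * P" "mat_adjoint M * mat_adjoint P = P * M"
    using assms d by (simp_all add: is_pinv_def hermitian_mat_def mat_adjoint_mult)
qed

lemma is_pinvI:
  assumes "dim_row P = dim_col M" "dim_col P = dim_row M" "M * (P * M) = M" "P * (M * P) = P"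
    "mat_adjoint (M * P) = M * P" "mat_adjoint (P * M) = P * M"
  shows "is_pinv M P"
  using assms unfolding is_pinv_def hermitian_mat_def
  by (intro conjI carrier_matI) (simp_all add: mult_assoc_dim)

lemma is_pinv_unique:
  assumes P: "is_pinv M P" and Q: "is_pinv M Q"
  shows "P = Q"
proof -
  note p = is_pinvD[OF P] and q = is_pinvD[OF Q]
  \<comment> \<open>\<open>M P\<close> and \<open>M Q\<close> are the orthogonal projections onto the same column space, \<open>P M\<close> and
    \<open>Q M\<close> those onto the same row space.\<close>
  have MPQ: "M * P = M * Q"
  proof -
    have "M * P = (M * (Q * M)) * P" by (simp only: q)
    also have "\<dots> = (M * Q) * (M * P)" using p(1,2) q(1,2) by (simp add: mult_assoc_dim)
    also have "\<dots> = (mat_adjoint Q * mat_adjoint M) * (mat_adjoint P * mat_adjoint M)"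
      by (simp only: p q)
    also have "\<dots> = mat_adjoint Q * mat_adjoint (M * (P * M))"
      using p(1,2) q(1,2) by (simp add: mat_adjoint_mult mult_assoc_dim)
    also have "\<dots> = M * Q" by (simp only: p q)
    finally show ?thesis .
  qed
  have PQM: "P * M = Q * M"
  proof -
    have "P * M = P * (M * (Q * M))" by (simp only: q)
    also have "\<dots> = (P * M) * (Q * M)" using p(1,2) q(1,2) by (simp add: mult_assoc_dim)
    also have "\<dots> = (mat_adjoint M * mat_adjoint P) * (mat_adjoint M * mat_adjoint Q)"
      by (simp only: p q)
    also have "\<dots> = mat_adjoint (M * (P * M)) * mat_adjoint Q"
      using p(1,2) q(1,2) by (simp add: mat_adjoint_mult mult_assoc_dim)
    also have "\<dots> = Q * M" by (simp only: p q)
    finally show ?thesis .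
  qed
  have "P = P * (M * Q)" by (simp only: p flip: MPQ)
  also have "\<dots> = (P * M) * Q" using p(1,2) q(1,2) by (simp add: mult_assoc_dim)
  also have "\<dots> = Q * (M * Q)" using q(1,2) by (simp only: PQM) (simp add: mult_assoc_dim)
  also have "\<dots> = Q" by (simp only: q)
  finally show ?thesis .
qed

lemma pinv_eqI: "is_pinv M P \<Longrightarrow> pinv M = P"
  unfolding pinv_def by (rule the_equality) (auto intro: is_pinv_unique)

text \<open>For any generalized inverse \<open>G\<close> of \<open>K = M\<^sup>* M M\<^sup>*\<close> the pseudoinverse of \<open>M\<close> is \<open>M\<^sup>* G M\<^sup>*\<close>:
  cancelling \<open>M\<^sup>*\<close> on both sides of \<open>K G K = K\<close> gives the first Penrose equation, and the other
  three follow from it because the product is bordered by \<open>M\<^sup>*\<close>.\<close>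

lemma is_pinv_pinv:
  fixes M :: "'a :: conjugatable_ordered_field mat"
  shows "is_pinv M (pinv M)"
proof -
  let ?A = "mat_adjoint M"
  let ?K = "?A * M * ?A"
  obtain G where G: "G \<in> carrier_mat (dim_col ?K) (dim_row ?K)" and KGK: "?K * G * ?K = ?K"
    using generalized_inverse_exists by blast
  define P where "P = ?A * G * ?A"
  have d: "dim_row G = dim_row M" "dim_col G = dim_col M"
    "dim_row P = dim_col M" "dim_col P = dim_row M" using G by (auto simp: P_def)
  have "?A * (M * (?A * G * ?A * M * ?A)) = ?A * (M * ?A)"
    using KGK d by (simp add: mult_assoc_dim)
  then have "M * (?A * G * ?A * M * ?A) = M * ?A"
    using adjoint_mult_cancel_left[of "?A * G * ?A * M * ?A" M ?A] d by simp
  then have "(M * ?A * G * ?A) * M * ?A = 1\<^sub>m (dim_row M) * M * ?A"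
    using d by (simp add: mult_assoc_dim left_mult_one_mat'[of _ "dim_row M"])
  then have "(M * ?A * G * ?A) * M = 1\<^sub>m (dim_row M) * M"
    using adjoint_mult_cancel_right[of "M * ?A * G * ?A" M "1\<^sub>m (dim_row M)"] d by simp
  then have MPM: "M * (P * M) = M"
    using d by (simp add: P_def mult_assoc_dim)
  then have "mat_adjoint (M * (P * M)) = ?A" by (simp only:)
  then have adj: "?A * (mat_adjoint P * ?A) = ?A"
    using d by (simp add: mat_adjoint_mult mult_assoc_dim)
  have MP: "M * P = (M * P) * mat_adjoint (M * P)"
  proof -
    have "M * P = M * ?A * G * ?A" using d by (simp add: P_def mult_assoc_dim)
    also have "\<dots> = M * ?A * G * (?A * (mat_adjoint P * ?A))" by (simp add: adj)
    also have "\<dots> = (M * P) * mat_adjoint (M * P)"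
      using d by (simp add: P_def mat_adjoint_mult mult_assoc_dim)
    finally show ?thesis .
  qed
  have PM: "P * M = mat_adjoint (P * M) * (P * M)"
  proof -
    have "P * M = ?A * G * ?A * M" using d by (simp add: P_def mult_assoc_dim)
    also have "\<dots> = (?A * (mat_adjoint P * ?A)) * G * ?A * M" by (simp add: adj)
    also have "\<dots> = mat_adjoint (P * M) * (P * M)"
      using d by (simp add: P_def mat_adjoint_mult mult_assoc_dim)
    finally show ?thesis .
  qed
  have hMP: "mat_adjoint (M * P) = M * P"
    using d by (subst (1 2) MP) (simp add: mat_adjoint_mult[of "M * P" "mat_adjoint (M * P)"])
  have hPM: "mat_adjoint (P * M) = P * M"
    using d by (subst (1 2) PM) (simp add: mat_adjoint_mult[of "mat_adjoint (P * M)" "P * M"])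
  have "P * (M * P) = ?A * G * (?A * mat_adjoint (M * P))"
    unfolding hMP using d by (simp add: P_def mult_assoc_dim)
  also have "\<dots> = P"
    using d adj by (simp add: P_def mat_adjoint_mult mult_assoc_dim)
  finally have "is_pinv M P"
    using d MPM hMP hPM by (intro is_pinvI) auto
  then show ?thesis using pinv_eqI by metis
qed

lemma dim_pinv [simp]:
  fixes M :: "'a :: conjugatable_ordered_field mat"
  shows "dim_row (pinv M) = dim_col M" "dim_col (pinv M) = dim_row M"
  using is_pinvD(1,2)[OF is_pinv_pinv] .

lemma pinv_adjoint:
  fixes M :: "'a :: conjugatable_ordered_field mat"
  shows "pinv (mat_adjoint M) = mat_adjoint (pinv M)"
proof (rule pinv_eqI)
  note p = is_pinvD[OF is_pinv_pinv[of M]]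
  have "mat_adjoint (M * (pinv M * M)) = mat_adjoint M"
    and "mat_adjoint (pinv M * (M * pinv M)) = mat_adjoint (pinv M)"
    by (simp_all only: p)
  then have "mat_adjoint M * (mat_adjoint (pinv M) * mat_adjoint M) = mat_adjoint M"
    and "mat_adjoint (pinv M) * (mat_adjoint M * mat_adjoint (pinv M)) = mat_adjoint (pinv M)"
    by (simp_all add: mat_adjoint_mult mult_assoc_dim)
  then show "is_pinv (mat_adjoint M) (mat_adjoint (pinv M))"
    by (intro is_pinvI) (simp_all add: p mat_adjoint_mult)
qed

lemma pinv_uminus:
  fixes M :: "'a :: conjugatable_ordered_field mat"
  shows "pinv (- M) = - pinv M"
proof (rule pinv_eqI)
  note p = is_pinvD[OF is_pinv_pinv[of M]]
  show "is_pinv (- M) (- pinv M)"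
    by (intro is_pinvI) (simp_all add: p mat_adjoint_mult)
qed

text \<open>The Penrose equations for \<open>B\<close> follow from those for \<open>B\<^sup>* B\<close>: the first by cancelling \<open>B\<^sup>*\<close>,
  the third because \<open>(B\<^sup>* B)\<^sup>+\<close> is Hermitian, the other two directly.\<close>

lemma pinv_eq_pinv_gram:
  fixes B :: "'a :: conjugatable_ordered_field mat"
  shows "pinv B = pinv (mat_adjoint B * B) * mat_adjoint B"
proof (rule pinv_eqI)
  let ?A = "mat_adjoint B"
  define P where "P = pinv (?A * B)"
  have d: "dim_row P = dim_col B" "dim_col P = dim_col B" by (simp_all add: P_def)
  note p = is_pinvD[OF is_pinv_pinv[of "?A * B"], folded P_def]
  have hP: "mat_adjoint P = P"
    using pinv_adjoint[of "?A * B"] by (simp add: P_def mat_adjoint_mult)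
  have "?A * (B * (P * ?A * B)) = ?A * (B * 1\<^sub>m (dim_col B))"
    using p(3) d by (simp add: mult_assoc_dim right_mult_one_mat'[of _ "dim_col B"])
  then have "B * (P * ?A * B) = B * 1\<^sub>m (dim_col B)"
    using d by (intro adjoint_mult_cancel_left[of _ B "1\<^sub>m (dim_col B)"]) simp_all
  then have "B * (P * ?A * B) = B" by simp
  moreover have "(P * ?A) * (B * (P * ?A)) = P * ?A"
  proof -
    have "(P * ?A) * (B * (P * ?A)) = (P * ((?A * B) * P)) * ?A"
      using d by (simp add: mult_assoc_dim)
    then show ?thesis by (simp only: p)
  qed
  moreover have "mat_adjoint (B * (P * ?A)) = B * (P * ?A)"
    using d by (simp add: mat_adjoint_mult hP mult_assoc_dim)
  moreover have "mat_adjoint (P * ?A * B) = P * ?A * B"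
    using d p(6) by (simp add: mat_adjoint_mult hP mult_assoc_dim)
  ultimately show "is_pinv B (P * ?A)"
    using d by (intro is_pinvI) simp_all
qed

section \<open>Reductions of semidefinite and skew-Hermitian matrices\<close>

definition reduction_core :: "'a :: conjugatable_field mat \<Rightarrow> 'a mat \<Rightarrow> 'a mat" where
  "reduction_core A X = X * pinv (mat_adjoint X * A * X) * mat_adjoint X"

context
  fixes A X :: "'a :: conjugatable_ordered_field mat" and m p :: nat
  assumes A: "A \<in> carrier_mat m m" and X: "X \<in> carrier_mat m p"
begin

lemma dims_A_X: "dim_row A = m" "dim_col A = m" "dim_row X = m" "dim_col X = p"
  using A X by auto

lemma dim_reduction_core:
  "dim_row (reduction_core A X) = m" "dim_col (reduction_core A X) = m"
  by (simp_all add: reduction_core_def dims_A_X)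

lemma wedderburn_R_core: "wedderburn_R A X = A - A * (reduction_core A X * A)"
  by (simp add: wedderburn_reduction_def reduction_core_def mult_assoc_dim dims_A_X)

text \<open>This is the second Penrose equation for \<open>X\<^sup>* A X\<close>, bordered by \<open>X\<close> and \<open>X\<^sup>*\<close>.\<close>

lemma reduction_core_outer_inverse:
  "reduction_core A X * (A * reduction_core A X) = reduction_core A X"
proof -
  let ?K = "mat_adjoint X * A * X"
  have "reduction_core A X * (A * reduction_core A X)
      = X * (pinv ?K * (?K * pinv ?K)) * mat_adjoint X"
    by (simp add: reduction_core_def mult_assoc_dim dims_A_X)
  also have "\<dots> = reduction_core A X"
    using is_pinvD(4)[OF is_pinv_pinv[of ?K]] by (simp add: reduction_core_def)
  finally show ?thesis .
qed

lemma reduction_core_adjoint: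
  "mat_adjoint (reduction_core A X) = reduction_core (mat_adjoint A) X"
  by (simp add: reduction_core_def mat_adjoint_mult mult_assoc_dim dims_A_X flip: pinv_adjoint)

text \<open>With \<open>C\<close> for the core, \<open>C A C = C\<close> turns the reduction into the congruence
  \<open>(I - C A)\<^sup>* A (I - C A)\<close>.\<close>

lemma psd_wedderburn_R:
  assumes psd: "psd_mat A"
  shows "psd_mat (wedderburn_R A X)"
proof -
  let ?C = "reduction_core A X" and ?R = "wedderburn_R A X"
  let ?T = "1\<^sub>m m - ?C * A"
  note d = dims_A_X dim_reduction_core
  have hA: "mat_adjoint A = A" using psd by (simp add: psd_mat_def hermitian_mat_def)
  then have hC: "mat_adjoint ?C = ?C" using reduction_core_adjoint by simp
  have "A * ((?C * (A * ?C)) * A) = A * (?C * A)"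
    by (simp only: reduction_core_outer_inverse)
  then have ACAC: "A * (?C * (A * (?C * A))) = A * (?C * A)"
    by (simp add: mult_assoc_dim d)
  have dR: "dim_row ?R = m" "dim_col ?R = m" by (simp_all add: wedderburn_R_core d)
  have "hermitian_mat ?R"
    by (simp add: hermitian_mat_def wedderburn_R_core mat_adjoint_minus mat_adjoint_mult hA hC
        mult_assoc_dim d)
  moreover have "0 \<le> (?R *\<^sub>v v) \<bullet>c v" if v: "v \<in> carrier_vec m" for v
  proof -
    have "mat_adjoint ?T * (A * ?T) = (A - A * (?C * A)) - (A * (?C * A) - A * (?C * A))"
      using ACAC
      by (simp add: mat_adjoint_minus mat_adjoint_mult hA hC minus_mult_distrib_dim
          mult_minus_distrib_dim mult_assoc_dim d left_mult_one_mat'[of _ m])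
    also have "\<dots> = ?R"
      by (intro eq_matI) (simp_all add: wedderburn_R_core d del: index_mult_mat(1))
    finally have R: "?R = mat_adjoint ?T * (A * ?T)" by simp
    have T: "?T \<in> carrier_mat m m" "mat_adjoint ?T \<in> carrier_mat m m"
      by (intro carrier_matI; simp add: d)+
    let ?w = "?T *\<^sub>v v"
    have "?w \<in> carrier_vec m" using T v by simp
    have "?R *\<^sub>v v = mat_adjoint ?T *\<^sub>v (A *\<^sub>v ?w)"
      using T A v by (simp add: R assoc_mult_mat_vec[of _ m m _ m])
    moreover have "(mat_adjoint ?T *\<^sub>v (A *\<^sub>v ?w)) \<bullet>c v = (A *\<^sub>v ?w) \<bullet>c ?w"
      using v by (intro adjoint_mult_vec_cscalar_prod carrier_vecI) (simp_all add: d)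
    ultimately have "(?R *\<^sub>v v) \<bullet>c v = (A *\<^sub>v ?w) \<bullet>c ?w" by (simp only:)
    also have "0 \<le> \<dots>" using psd \<open>?w \<in> carrier_vec m\<close> d by (simp add: psd_mat_def)
    finally show ?thesis .
  qed
  ultimately show ?thesis by (simp add: psd_mat_def dR)
qed

lemma skew_hermitian_wedderburn_R:
  assumes "skew_hermitian_mat A"
  shows "skew_hermitian_mat (wedderburn_R A X)"
proof -
  let ?C = "reduction_core A X"
  have hA: "mat_adjoint A = - A" using assms by (simp add: skew_hermitian_mat_def)
  have hC: "mat_adjoint ?C = - ?C"
    using reduction_core_adjoint
    by (simp add: hA reduction_core_def pinv_uminus dims_A_X)
  show ?thesis
    unfolding skew_hermitian_mat_def wedderburn_R_core
    by (intro eq_matI)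
       (simp_all add: mat_adjoint_minus mat_adjoint_mult hA hC mult_assoc_dim dims_A_X dim_reduction_core
        del: index_mult_mat(1))
qed

lemma wedderburn_R_square_root:
  assumes S: "S \<in> carrier_mat m m" and hS: "hermitian_mat S" and SS: "S * S = A"
  shows "wedderburn_R A X
      = S * (1\<^sub>m m - (S * X) * pinv (mat_adjoint (S * X) * (S * X)) * mat_adjoint (S * X)) * S"
proof -
  have d: "dim_row S = m" "dim_col S = m" using S by auto
  have hS': "mat_adjoint S = S" using hS by (simp add: hermitian_mat_def)
  have K: "mat_adjoint X * A * X = mat_adjoint X * (S * (S * X))"
    using d dims_A_X by (simp add: mult_assoc_dim flip: SS)
  show ?thesis
    unfolding wedderburn_reduction_def K
    using d dims_A_X
    by (simp add: mat_adjoint_mult hS' mult_assoc_dim mult_minus_distrib_dim minus_mult_distrib_dim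
        left_mult_one_mat'[of _ m] flip: SS)
qed

end

lemma semidefinite_reduction:
  fixes A :: "'a :: conjugatable_ordered_field mat"
  assumes A: "A \<in> carrier_mat m m" and X: "X \<in> carrier_mat m p" and psd: "psd_mat A"
  shows "psd_mat (wedderburn_R A X) \<and>
         (\<forall>S \<in> carrier_mat m m. hermitian_mat S \<and> S * S = A \<longrightarrow>
            (let B = S * X in
               wedderburn_R A X
                 = S * (1\<^sub>m m - B * pinv (mat_adjoint B * B) * mat_adjoint B) * S \<and>
               S * (1\<^sub>m m - B * pinv (mat_adjoint B * B) * mat_adjoint B) * S
                 = S * (1\<^sub>m m - B * pinv B) * S))"
proof -
  have "B * pinv (mat_adjoint B * B) * mat_adjoint B = B * pinv B" for B :: "'a mat"
    by (simp add: pinv_eq_pinv_gram[of B] mult_assoc_dim)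
  then show ?thesis
    using psd_wedderburn_R[OF A X psd] wedderburn_R_square_root[OF A X] by (simp add: Let_def)
qed

section \<open>Passing from real to complex matrices\<close>

abbreviation (input) cmat :: "real mat \<Rightarrow> complex mat" where
  "cmat \<equiv> map_mat complex_of_real"

lemma cmat_mult: "dim_col A = dim_row B \<Longrightarrow> cmat (A * B) = cmat A * cmat B"
  by (rule of_real_hom.mat_hom_mult[of A "dim_row A" "dim_row B" B "dim_col B"]) auto

lemma cmat_minus: "dim_row A = dim_row B \<Longrightarrow> dim_col A = dim_col B \<Longrightarrow> cmat (A - B) = cmat A - cmat B"
  by (rule eq_matI) auto

lemma cmat_adjoint: "mat_adjoint (cmat A) = cmat (mat_adjoint A)"
  by (rule eq_matI) auto

lemma cmat_eq_iff: "cmat A = cmat B \<longleftrightarrow> A = B"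
  by (auto simp: mat_eq_iff)

lemma pinv_cmat: "pinv (cmat M) = cmat (pinv M)"
proof (rule pinv_eqI)
  note p = is_pinvD[OF is_pinv_pinv[of M]]
  show "is_pinv (cmat M) (cmat (pinv M))"
    by (intro is_pinvI) (simp_all add: p mat_adjoint_mult cmat_adjoint flip: cmat_mult)
qed

lemma wedderburn_R_cmat:
  assumes "A \<in> carrier_mat m m" "X \<in> carrier_mat m p"
  shows "wedderburn_R (cmat A) (cmat X) = cmat (wedderburn_R A X)"
proof -
  have d: "dim_row A = m" "dim_col A = m" "dim_row X = m" "dim_col X = p" using assms by auto
  have "pinv (mat_adjoint (cmat X) * cmat A * cmat X) = cmat (pinv (mat_adjoint X * A * X))"
    by (simp add: d cmat_adjoint flip: cmat_mult pinv_cmat)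
  then show ?thesis
    by (simp add: wedderburn_reduction_def cmat_adjoint cmat_minus cmat_mult d)
qed

lemma normal_mat_cmat:
  assumes "A \<in> carrier_mat m m"
  shows "normal_mat (cmat A) \<longleftrightarrow> normal_mat A"
proof -
  have d: "dim_row A = m" "dim_col A = m" using assms by auto
  then show ?thesis
    by (simp add: normal_mat_def cmat_adjoint cmat_eq_iff flip: cmat_mult)
qed

lemma nilpotent_mat_cmat:
  assumes "A \<in> carrier_mat m m"
  shows "nilpotent_mat (cmat A) \<longleftrightarrow> nilpotent_mat A"
proof -
  have d: "dim_row A = m" "dim_col A = m" using assms by auto
  have "cmat A ^\<^sub>m k = cmat (A ^\<^sub>m k)" for k
    by (rule of_real_hom.mat_hom_pow[OF assms, symmetric])
  moreover have "0\<^sub>m m m = cmat (0\<^sub>m m m)" by (rule eq_matI) auto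
  ultimately show ?thesis using d by (simp add: nilpotent_mat_def cmat_eq_iff)
qed

section \<open>Diagonalizability, nilpotency and reduction by one column\<close>

lemma commutator_adjoint_eq_zero_iff:
  assumes "B \<in> carrier_mat m m"
  shows "commutator_mat B (mat_adjoint B) = 0\<^sub>m m m \<longleftrightarrow> normal_mat B"
proof -
  have d: "dim_row B = m" "dim_col B = m" using assms by auto
  then show ?thesis
    using eq_mat_iff_minus_eq_zero[of "B * mat_adjoint B" "mat_adjoint B * B"]
    by (simp add: commutator_mat_def normal_mat_def)
qed

text \<open>The eigenvectors are the columns of \<open>P\<close>; over a field a right inverse of a square matrix is
  an inverse.\<close>

lemma diagonalizable_matI:
  fixes A :: "'a :: field mat"
  assumes A: "A \<in> carrier_mat n n" and P: "P \<in> carrier_mat n n" and D: "D \<in> carrier_mat n n"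
    and Q: "Q \<in> carrier_mat n n"
    and diag: "diagonal_mat D" and AP: "A * P = P * D" and PQ: "P * Q = 1\<^sub>m n"
  shows "diagonalizable_mat A"
proof -
  have "A = A * (P * Q)" using A by (simp add: PQ)
  also have "\<dots> = P * D * Q" using A P Q AP by (simp add: mult_assoc_dim flip: AP)
  finally have "similar_mat A D"
    using A P D Q PQ mat_mult_left_right_inverse[OF P Q PQ]
    by (intro similar_matI[of _ _ P Q n]) auto
  then show ?thesis using diag by (auto simp: diagonalizable_mat_def)
qed

lemma diagonalizable_matE:
  assumes "diagonalizable_mat A" and "A \<in> carrier_mat n n"
  obtains D P Q where "diagonal_mat D" "D \<in> carrier_mat n n" "P \<in> carrier_mat n n"
    "Q \<in> carrier_mat n n" "P * Q = 1\<^sub>m n" "Q * P = 1\<^sub>m n" "A = P * D * Q"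
  using assms by (fastforce simp: diagonalizable_mat_def similar_mat_def similar_mat_wit_def Let_def)

lemma diagonal_mat_mult_left:
  fixes D :: "'a :: semiring_0 mat"
  assumes "diagonal_mat D" "D \<in> carrier_mat n n" "G \<in> carrier_mat n k" "i < n" "j < k"
  shows "(D * G) $$ (i, j) = D $$ (i, i) * G $$ (i, j)"
proof -
  have "(D * G) $$ (i, j) = (\<Sum>l\<in>{0..<n}. if l = i then D $$ (i, i) * G $$ (i, j) else 0)"
    using assms carrier_matD[OF assms(2)] carrier_matD[OF assms(3)]
    by (auto simp: scalar_prod_def diagonal_mat_def simp del: sum.delta sum.delta' intro!: sum.cong)
  then show ?thesis using assms by simp
qed

lemma diagonal_mat_mult_right:
  fixes D :: "'a :: semiring_0 mat"
  assumes "diagonal_mat D" "D \<in> carrier_mat n n" "G \<in> carrier_mat k n" "i < k" "j < n"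
  shows "(G * D) $$ (i, j) = G $$ (i, j) * D $$ (j, j)"
proof -
  have "(G * D) $$ (i, j) = (\<Sum>l\<in>{0..<n}. if l = j then G $$ (i, j) * D $$ (j, j) else 0)"
    using assms carrier_matD[OF assms(2)] carrier_matD[OF assms(3)]
    by (auto simp: scalar_prod_def diagonal_mat_def simp del: sum.delta sum.delta' intro!: sum.cong)
  then show ?thesis using assms by simp
qed

text \<open>The diagonal form also squares to zero, so its diagonal entries do.\<close>

lemma diagonalizable_square_zero:
  fixes M :: "'a :: field mat"
  assumes diag: "diagonalizable_mat M" and M: "M \<in> carrier_mat n n" and MM: "M * M = 0\<^sub>m n n"
  shows "M = 0\<^sub>m n n"
proof -
  obtain D P Q where D: "diagonal_mat D" "D \<in> carrier_mat n n" and P: "P \<in> carrier_mat n n"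
    and Q: "Q \<in> carrier_mat n n" and QP: "Q * P = 1\<^sub>m n" and M_eq: "M = P * D * Q"
    using diagonalizable_matE[OF diag M] by metis
  have d: "dim_row D = n" "dim_col D = n" "dim_row P = n" "dim_col P = n" "dim_row Q = n" "dim_col Q = n"
    "dim_row M = n" "dim_col M = n"
    using D P Q M by auto
  have "Q * M * P = (Q * P) * D * (Q * P)" by (simp add: M_eq mult_assoc_dim d)
  also have "\<dots> = D" using D by (simp add: QP)
  finally have D_eq: "Q * M * P = D" .
  have "D * D = (Q * M) * (P * D)" by (simp add: mult_assoc_dim d flip: D_eq)
  also have "P * D = M * P"
    using D P by (simp add: M_eq mult_assoc_dim d QP)
  also have "(Q * M) * (M * P) = Q * (M * M) * P" by (simp add: mult_assoc_dim d)
  also have "\<dots> = 0\<^sub>m n n" using P Q by (simp add: MM)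
  finally have DD: "D * D = 0\<^sub>m n n" .
  have "D $$ (i, i) = 0" if i: "i < n" for i
    using diagonal_mat_mult_left[OF D D(2) i i] i by (simp add: DD)
  then have "D = 0\<^sub>m n n"
    using D by (intro eq_matI) (auto simp: diagonal_mat_def d)
  then show ?thesis using P Q by (simp add: M_eq)
qed

text \<open>A real eigenvalue of a real orthogonal matrix preserves the length of its eigenvector and so
  is \<open>1\<close> or \<open>-1\<close>; if there is a basis of eigenvectors, the matrix squares to the identity.\<close>

lemma orthogonal_diagonalizable_involution:
  fixes A :: "real mat"
  assumes diag: "diagonalizable_mat A" and A: "A \<in> carrier_mat n n"
    and orth: "mat_adjoint A * A = 1\<^sub>m n"
  shows "A * A = 1\<^sub>m n"
proof -
  obtain D P Q where D: "diagonal_mat D" "D \<in> carrier_mat n n" and P: "P \<in> carrier_mat n n"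
    and Q: "Q \<in> carrier_mat n n" and PQ: "P * Q = 1\<^sub>m n" and QP: "Q * P = 1\<^sub>m n"
    and A_eq: "A = P * D * Q"
    using diagonalizable_matE[OF diag A] by metis
  have d: "dim_row D = n" "dim_col D = n" "dim_row P = n" "dim_col P = n" "dim_row Q = n" "dim_col Q = n"
    "dim_row A = n" "dim_col A = n"
    using D P Q A by auto
  have PD: "P * D = A * P" using D P by (simp add: A_eq mult_assoc_dim d QP)
  have adjD: "mat_adjoint D = D"
    using D(1) by (intro eq_matI) (auto simp: d diagonal_mat_def, metis)
  define G where "G = mat_adjoint P * P"
  have G: "G \<in> carrier_mat n n" by (intro carrier_matI) (simp_all add: G_def d)
  have "D * (G * D) = mat_adjoint (P * D) * (P * D)"
    by (simp add: G_def mat_adjoint_mult mult_assoc_dim d adjD)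
  also have "\<dots> = mat_adjoint P * ((mat_adjoint A * A) * P)"
    by (simp add: PD mat_adjoint_mult mult_assoc_dim d)
  also have "\<dots> = G" using P by (simp add: orth G_def)
  finally have DGD: "D * (G * D) = G" .
  have dd: "D $$ (i, i) * D $$ (i, i) = 1" if i: "i < n" for i
  proof -
    have "G $$ (i, i) = D $$ (i, i) * (G * D) $$ (i, i)"
      using diagonal_mat_mult_left[OF D, of "G * D" n i i] D G i by (simp add: DGD)
    then have *: "G $$ (i, i) = D $$ (i, i) * D $$ (i, i) * G $$ (i, i)"
      using diagonal_mat_mult_right[OF D G i i] by simp
    have "G $$ (i, i) \<noteq> 0"
    proof
      assume "G $$ (i, i) = 0"
      \<comment> \<open>\<open>G\<close> is the Gram matrix of the eigenvectors.\<close>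
      then have "col P i \<bullet>c col P i = 0"
        using i by (simp add: G_def d scalar_prod_def)
      then have "col P i = 0\<^sub>v n"
        using conjugate_square_eq_0_vec[of "col P i" n] P by auto
      then have "(Q * P) $$ (i, i) = 0" using i Q d by simp
      then show False using i by (simp add: QP)
    qed
    with * show ?thesis by simp
  qed
  have "D * D = 1\<^sub>m n"
  proof (rule eq_matI)
    fix i j assume "i < dim_row (1\<^sub>m n :: real mat)" "j < dim_col (1\<^sub>m n :: real mat)"
    then have ij: "i < n" "j < n" by auto
    then show "(D * D) $$ (i, j) = 1\<^sub>m n $$ (i, j)"
      using diagonal_mat_mult_left[OF D D(2) ij] D(1) dd by (auto simp: d diagonal_mat_def)
  qed (use D in auto)
  then have "P * (D * D) * Q = 1\<^sub>m n" using P PQ by simp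
  moreover have "A * A = P * (D * ((Q * P) * (D * Q)))"
    by (simp add: A_eq mult_assoc_dim d)
  ultimately show ?thesis using D Q by (simp add: QP mult_assoc_dim d)
qed

lemma eigenvalue_not_nilpotent:
  fixes N :: "'a :: field mat"
  assumes N: "N \<in> carrier_mat n n" and ev: "eigenvector N v k" and k: "k \<noteq> 0"
  shows "\<not> nilpotent_mat N"
proof
  assume "nilpotent_mat N"
  then obtain l where l: "N ^\<^sub>m l = 0\<^sub>m n n" using N by (auto simp: nilpotent_mat_def)
  have v: "v \<in> carrier_vec n" "v \<noteq> 0\<^sub>v n" using ev N by (auto simp: eigenvector_def)
  have "0\<^sub>m n n *\<^sub>v v = 0\<^sub>v n" using v by (intro eq_vecI) auto
  then have "k ^ l \<cdot>\<^sub>v v = 0\<^sub>v n" using eigenvector_pow[OF N ev, of l] by (simp add: l)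
  moreover have "v $ i = 0" if "(k ^ l \<cdot>\<^sub>v v) $ i = 0" "i < n" for i
    using that v k by simp
  ultimately have "v = 0\<^sub>v n" using v by (intro eq_vecI) auto
  then show False using v by simp
qed

text \<open>For a single column \<open>x\<close> the pseudoinverse is that of the scalar \<open>x\<^sup>* A x\<close>.\<close>

lemma wedderburn_R_column_index:
  fixes A X :: "'a :: conjugatable_ordered_field mat"
  assumes A: "A \<in> carrier_mat m m" and X: "X \<in> carrier_mat m 1"
    and c: "(mat_adjoint X * A * X) $$ (0, 0) = c" "c \<noteq> 0" and ij: "i < m" "j < m"
  shows "wedderburn_R A X $$ (i, j)
      = A $$ (i, j) - (A * X) $$ (i, 0) * (mat_adjoint X * A) $$ (0, j) / c"
proof -
  let ?K = "mat_adjoint X * A * X"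
  let ?P = "pinv ?K"
  have d: "dim_row A = m" "dim_col A = m" "dim_row X = m" "dim_col X = 1" using A X by auto
  have single: "(M * N) $$ (i, j) = M $$ (i, 0) * N $$ (0, j)"
    if "dim_col M = 1" "dim_row N = 1" "i < dim_row M" "j < dim_col N" for M N :: "'a mat" and i j
    using that by (simp add: scalar_prod_def)
  have dK: "dim_row ?K = 1" "dim_col ?K = 1" "dim_row ?P = 1" "dim_col ?P = 1" by (simp_all add: d)
  have "(?K * (?P * ?K)) $$ (0, 0) = c"
    using is_pinvD(3)[OF is_pinv_pinv[of ?K]] c by simp
  moreover have "(?K * (?P * ?K)) $$ (0, 0) = c * (?P $$ (0, 0) * c)"
    using dK c(1) by (simp only: single index_mult_mat(2,3))
  ultimately have P: "?P $$ (0, 0) = 1 / c" using c by (simp add: field_simps)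
  have "(A * X * ?P * (mat_adjoint X * A)) $$ (i, j)
      = (A * X) $$ (i, 0) * ?P $$ (0, 0) * (mat_adjoint X * A) $$ (0, j)"
    using ij dK d by (simp only: single index_mult_mat(2,3) dim_mat_adjoint)
  then show ?thesis
    using ij by (simp add: wedderburn_reduction_def d P del: index_mult_mat(1))
qed

section \<open>The examples\<close>

lemma less_3_cases: "i < 3 \<longleftrightarrow> i = 0 \<or> i = 1 \<or> i = (2 :: nat)"
  by auto

lemma less_4_cases: "i < 4 \<longleftrightarrow> i = 0 \<or> i = 1 \<or> i = 2 \<or> i = (3 :: nat)"
  by auto

lemma sum_upto_3: "(\<Sum>i = 0..<3. f i) = f 0 + f 1 + f (2 :: nat)"
  and sum_upto_4: "(\<Sum>i = 0..<4. f i) = f 0 + f 1 + f 2 + f (3 :: nat)"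
  by (simp_all add: numeral_eq_Suc)

lemma dim_mat_of_rows_list:
  "dim_row (mat_of_rows_list n rs) = length rs" "dim_col (mat_of_rows_list n rs) = n"
  by (simp_all add: mat_of_rows_list_def)

lemma index_mat_of_rows_list:
  "i < length rs \<Longrightarrow> j < n \<Longrightarrow> mat_of_rows_list n rs $$ (i, j) = rs ! i ! j"
  by (simp add: mat_of_rows_list_def)

lemmas mat_entries = scalar_prod_def sum_upto_3 sum_upto_4 dim_mat_of_rows_list index_mat_of_rows_list
  less_3_cases less_4_cases less_Suc_eq

subsection \<open>A normal matrix with a reduction that is not normal\<close>

definition normal_example :: "real mat" where
  "normal_example = (1 / sqrt 6) \<cdot>\<^sub>m mat_of_rows_list 3
     [[sqrt 3, 0, sqrt 3], [- sqrt 2, sqrt 2, sqrt 2], [1, 2, - 1]]"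

definition normal_column :: "real mat" where
  "normal_column = mat_of_rows_list 1 [[1], [0], [1]]"

definition normal_reduced :: "real mat" where
  "normal_reduced = (1 / sqrt 6) \<cdot>\<^sub>m mat_of_rows_list 3
     [[- 1, - 2, 1], [- sqrt 2, sqrt 2, sqrt 2], [1, 2, - 1]]"

lemma normal_carrier:
  "normal_example \<in> carrier_mat 3 3" "normal_column \<in> carrier_mat 3 1"
  "normal_reduced \<in> carrier_mat 3 3"
  by (auto intro!: carrier_matI
      simp: normal_example_def normal_column_def normal_reduced_def dim_mat_of_rows_list)

lemma sqrt6: "sqrt 6 = sqrt 2 * sqrt 3"
  by (simp flip: real_sqrt_mult)

text \<open>The matrix is orthogonal, which gives both its normality and, by way of
  \<open>orthogonal_diagonalizable_involution\<close>, that it is not diagonalizable over the reals.\<close>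

lemma orthogonal_normal_example:
  "mat_adjoint normal_example * normal_example = 1\<^sub>m 3"
  "normal_example * mat_adjoint normal_example = 1\<^sub>m 3"
proof -
  show *: "mat_adjoint normal_example * normal_example = 1\<^sub>m 3"
    by (rule eq_matI) (auto simp: normal_example_def mat_entries field_simps)
  show "normal_example * mat_adjoint normal_example = 1\<^sub>m 3"
    using normal_carrier(1)
    by (intro mat_mult_left_right_inverse[OF _ _ *] carrier_matI) auto
qed

lemma wedderburn_R_normal_example: "wedderburn_R normal_example normal_column = normal_reduced"
proof (rule eq_matI)
  note c = normal_carrier
  have K: "(mat_adjoint normal_column * normal_example * normal_column) $$ (0, 0) = sqrt 2"
    by (simp add: normal_example_def normal_column_def mat_entries sqrt6 field_simps)
  fix i j assume "i < dim_row normal_reduced" "j < dim_col normal_reduced"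
  then have ij: "i < 3" "j < 3" using c by auto
  show "wedderburn_R normal_example normal_column $$ (i, j) = normal_reduced $$ (i, j)"
    using ij
    by (subst wedderburn_R_column_index[OF c(1,2) K _ ij])
       (auto simp: normal_example_def normal_column_def normal_reduced_def mat_entries sqrt6 field_simps)
qed (use normal_carrier in \<open>auto simp: wedderburn_reduction_def\<close>)

lemma not_normal_normal_reduced: "\<not> normal_mat normal_reduced"
proof
  assume "normal_mat normal_reduced"
  then have "(normal_reduced * mat_adjoint normal_reduced) $$ (0, 0)
      = (mat_adjoint normal_reduced * normal_reduced) $$ (0, 0)"
    by (simp add: normal_mat_def)
  then show False
    by (simp add: normal_reduced_def mat_entries field_simps)
qed

lemma not_diagonalizable_normal_example: "\<not> diagonalizable_mat normal_example"
proof
  assume "diagonalizable_mat normal_example"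
  then have "(normal_example * normal_example) $$ (0, 0) = 1"
    using orthogonal_diagonalizable_involution[OF _ normal_carrier(1) orthogonal_normal_example(1)]
    by simp
  then have "sqrt 3 = 3"
    by (simp add: normal_example_def mat_entries field_simps)
  then have "sqrt 3 * sqrt 3 = 3 * 3" by simp
  then show False by simp
qed

text \<open>The kernel of the reduced matrix is spanned by \<open>(1, 0, 1)\<close>.  On its range, the span of
  \<open>(1, 0, -1)\<close> and \<open>(0, 1, 0)\<close>, the eigenvalues of \<open>sqrt 6\<close> times the matrix are the two
  roots \<open>\<lambda>\<close> of \<open>\<lambda>\<^sup>2 + (2 - sqrt 2) \<lambda> = 6 sqrt 2\<close>, which are real and distinct, with eigenvectors
  \<open>(2, -(2 + \<lambda>), -2)\<close>.\<close>

lemma diagonalizable_normal_reduced: "diagonalizable_mat normal_reduced"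
proof -
  define e where "e = sqrt ((2 - sqrt 2) ^ 2 + 24 * sqrt 2)"
  define x where "x = (sqrt 2 - 2 + e) / 2"
  define y where "y = (sqrt 2 - 2 - e) / 2"
  have e: "e > 0" by (auto simp: e_def intro!: add_nonneg_pos)
  have ee: "e * e = (2 - sqrt 2) * (2 - sqrt 2) + 24 * sqrt 2"
    by (simp add: e_def power2_eq_square)
  have x: "x * x = 6 * sqrt 2 + sqrt 2 * x - 2 * x" and y: "y * y = 6 * sqrt 2 + sqrt 2 * y - 2 * y"
    using ee by (simp_all add: x_def y_def field_simps)
  have x_eq: "x = y + e" by (simp add: x_def y_def field_simps)
  define P where "P = mat_of_rows_list 3 [[1, 2, 2], [0, - (2 + x), - (2 + y)], [1, - 2, - 2]]"
  define D where "D = mat_of_rows_list 3 [[0, 0, 0], [0, x / sqrt 6, 0], [0, 0, y / sqrt 6]]"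
  define Q where "Q = mat_of_rows_list 3
    [[1 / 2, 0, 1 / 2], [- (2 + y) / (4 * e), - 1 / e, (2 + y) / (4 * e)],
     [(2 + x) / (4 * e), 1 / e, - (2 + x) / (4 * e)]]"
  have "P \<in> carrier_mat 3 3" "D \<in> carrier_mat 3 3" "Q \<in> carrier_mat 3 3"
    by (auto intro!: carrier_matI simp: P_def D_def Q_def dim_mat_of_rows_list)
  moreover have "diagonal_mat D"
    by (auto simp: diagonal_mat_def D_def mat_entries)
  moreover have "normal_reduced * P = P * D"
    by (rule eq_matI) (auto simp: normal_reduced_def P_def D_def mat_entries x y field_simps)
  moreover have "P * Q = 1\<^sub>m 3"
    using e by (intro eq_matI) (auto simp: P_def Q_def mat_entries x_eq field_simps)
  ultimately show ?thesis
    using normal_carrier(3) by (intro diagonalizable_matI[of _ 3 P D Q])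
qed

subsection \<open>A diagonalizable matrix with a reduction that is not diagonalizable\<close>

text \<open>Reduction by the first unit vector leaves the Schur complement of the corner entry.  The matrix
  is chosen so that this complement is a nilpotent Jordan block while the eigenvalues \<open>0, 2, -1\<close> are
  distinct.\<close>

lemma diagonalizable_with_defective_reduction:
  "\<exists>m p. \<exists>A \<in> carrier_mat m m. \<exists>X \<in> carrier_mat m p.
     diagonalizable_mat (A :: real mat) \<and> \<not> diagonalizable_mat (wedderburn_R A X)"
proof -
  define A :: "real mat" where "A = mat_of_rows_list 3 [[1, 1, 0], [0, 0, 1], [2, 2, 0]]"
  define X :: "real mat" where "X = mat_of_rows_list 1 [[1], [0], [0]]"
  define P :: "real mat" where "P = mat_of_rows_list 3 [[1, 1, 1], [- 1, 1, - 2], [0, 2, 2]]"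
  define D :: "real mat" where "D = mat_of_rows_list 3 [[0, 0, 0], [0, 2, 0], [0, 0, - 1]]"
  define Q :: "real mat" where "Q = mat_of_rows_list 3
    [[1, 0, - 1 / 2], [1 / 3, 1 / 3, 1 / 6], [- 1 / 3, - 1 / 3, 1 / 3]]"
  have c: "A \<in> carrier_mat 3 3" "X \<in> carrier_mat 3 1" "P \<in> carrier_mat 3 3" "D \<in> carrier_mat 3 3"
    "Q \<in> carrier_mat 3 3"
    by (auto intro!: carrier_matI simp: A_def X_def P_def D_def Q_def dim_mat_of_rows_list)
  have "diagonal_mat D"
    by (auto simp: diagonal_mat_def D_def mat_entries)
  moreover have "A * P = P * D"
    by (rule eq_matI) (auto simp: A_def P_def D_def mat_entries)
  moreover have "P * Q = 1\<^sub>m 3"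
    by (rule eq_matI) (auto simp: P_def Q_def mat_entries)
  ultimately have "diagonalizable_mat A"
    using c by (intro diagonalizable_matI[of _ 3 P D Q])
  moreover have "\<not> diagonalizable_mat (wedderburn_R A X)"
  proof
    assume diag: "diagonalizable_mat (wedderburn_R A X)"
    define R :: "real mat" where "R = mat_of_rows_list 3 [[0, 0, 0], [0, 0, 1], [0, 0, 0]]"
    have cR: "R \<in> carrier_mat 3 3"
      by (auto intro!: carrier_matI simp: R_def dim_mat_of_rows_list)
    have "wedderburn_R A X = R"
    proof (rule eq_matI)
      have K: "(mat_adjoint X * A * X) $$ (0, 0) = 1"
        by (simp add: A_def X_def mat_entries)
      fix i j assume "i < dim_row R" "j < dim_col R"
      then have ij: "i < 3" "j < 3" using cR by auto
      show "wedderburn_R A X $$ (i, j) = R $$ (i, j)"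
        using ij
        by (subst wedderburn_R_column_index[OF c(1,2) K _ ij])
           (auto simp: A_def X_def R_def mat_entries)
    qed (use c cR in \<open>auto simp: wedderburn_reduction_def\<close>)
    moreover have "R * R = 0\<^sub>m 3 3"
      by (rule eq_matI) (auto simp: R_def mat_entries)
    ultimately have "R = 0\<^sub>m 3 3"
      using diagonalizable_square_zero[OF _ cR] diag by simp
    then have "R $$ (1, 2) = 0" by simp
    then show False by (simp add: R_def mat_entries)
  qed
  ultimately show ?thesis using c by blast
qed

subsection \<open>A nilpotent matrix with a reduction that is not nilpotent\<close>

definition nilpotent_example :: "real mat" where
  "nilpotent_example = mat_of_rows_list 4 [[0, 1, 0, 0], [0, 0, 1, 0], [0, 0, 0, 1], [0, 0, 0, 0]]"

definition nilpotent_column :: "real mat" where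
  "nilpotent_column = mat_of_rows_list 1 [[1], [1], [1], [0]]"

definition nilpotent_reduced :: "real mat" where
  "nilpotent_reduced = (1 / 2 :: real) \<cdot>\<^sub>m mat_of_rows_list 4
     [[0, 1, - 1, - 1], [0, - 1, 1, - 1], [0, 0, 0, 2], [0, 0, 0, 0]]"

lemma nilpotent_carrier:
  "nilpotent_example \<in> carrier_mat 4 4" "nilpotent_column \<in> carrier_mat 4 1"
  "nilpotent_reduced \<in> carrier_mat 4 4"
  by (auto intro!: carrier_matI
      simp: nilpotent_example_def nilpotent_column_def nilpotent_reduced_def dim_mat_of_rows_list)

lemma nilpotent_mat_example: "nilpotent_mat nilpotent_example"
proof -
  let ?N = nilpotent_example
  define N2 :: "real mat" where
    "N2 = mat_of_rows_list 4 [[0, 0, 1, 0], [0, 0, 0, 1], [0, 0, 0, 0], [0, 0, 0, 0]]"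
  have N2: "?N * ?N = N2"
    by (rule eq_matI) (auto simp: nilpotent_example_def N2_def mat_entries)
  have c: "dim_row ?N = 4" "dim_col ?N = 4" using nilpotent_carrier by auto
  have "N2 * N2 = 0\<^sub>m 4 4"
    by (rule eq_matI) (auto simp: N2_def mat_entries)
  then have "?N ^\<^sub>m 4 = 0\<^sub>m 4 4"
    by (simp add: numeral_eq_Suc mult_assoc_dim c left_mult_one_mat'[of _ 4] flip: N2)
  then show ?thesis using c by (auto simp: nilpotent_mat_def)
qed

lemma wedderburn_R_nilpotent_example:
  "wedderburn_R nilpotent_example nilpotent_column = nilpotent_reduced"
proof (rule eq_matI)
  note c = nilpotent_carrier
  have K: "(mat_adjoint nilpotent_column * nilpotent_example * nilpotent_column) $$ (0, 0) = 2"
    by (simp add: nilpotent_example_def nilpotent_column_def mat_entries)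
  fix i j assume "i < dim_row nilpotent_reduced" "j < dim_col nilpotent_reduced"
  then have ij: "i < 4" "j < 4" using c by auto
  show "wedderburn_R nilpotent_example nilpotent_column $$ (i, j) = nilpotent_reduced $$ (i, j)"
    using ij
    by (subst wedderburn_R_column_index[OF c(1,2) K _ ij])
       (auto simp: nilpotent_example_def nilpotent_column_def nilpotent_reduced_def mat_entries)
qed (use nilpotent_carrier in \<open>auto simp: wedderburn_reduction_def\<close>)

lemma not_nilpotent_reduced: "\<not> nilpotent_mat nilpotent_reduced"
proof (rule eigenvalue_not_nilpotent[OF nilpotent_carrier(3)])
  let ?v = "vec_of_list [1, - 1, 0, 0 :: real]"
  have "nilpotent_reduced *\<^sub>v ?v = (- 1 / 2) \<cdot>\<^sub>v ?v"
    by (rule eq_vecI) (auto simp: nilpotent_reduced_def mat_entries vec_of_list_index)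
  moreover have "?v $ 0 \<noteq> 0\<^sub>v 4 $ 0" by (simp add: vec_of_list_index)
  then have "?v \<noteq> 0\<^sub>v 4" by metis
  ultimately show "eigenvector nilpotent_reduced ?v (- 1 / 2)"
    using nilpotent_carrier by (auto simp: eigenvector_def intro!: carrier_vecI)
qed simp

theorem mainTheorem7:
  shows
    "\<comment> \<open>(i)\<close>
     ((\<forall>m p. \<forall>A \<in> carrier_mat m m. \<forall>X \<in> carrier_mat m p. psd_mat (A :: real mat) \<longrightarrow>
         psd_mat (wedderburn_R A X) \<and>
         (\<forall>S \<in> carrier_mat m m. hermitian_mat S \<and> S * S = A \<longrightarrow>
            (let B = S * X in
               wedderburn_R A X
                 = S * (1\<^sub>m m - B * pinv (mat_adjoint B * B) * mat_adjoint B) * S \<and>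
               S * (1\<^sub>m m - B * pinv (mat_adjoint B * B) * mat_adjoint B) * S
                 = S * (1\<^sub>m m - B * pinv B) * S))) \<and>
      (\<forall>m p. \<forall>A \<in> carrier_mat m m. \<forall>X \<in> carrier_mat m p. psd_mat (A :: complex mat) \<longrightarrow>
         psd_mat (wedderburn_R A X) \<and>
         (\<forall>S \<in> carrier_mat m m. hermitian_mat S \<and> S * S = A \<longrightarrow>
            (let B = S * X in
               wedderburn_R A X
                 = S * (1\<^sub>m m - B * pinv (mat_adjoint B * B) * mat_adjoint B) * S \<and>
               S * (1\<^sub>m m - B * pinv (mat_adjoint B * B) * mat_adjoint B) * S
                 = S * (1\<^sub>m m - B * pinv B) * S)))) \<and>
    \<comment> \<open>(ii)\<close>
     ((\<forall>m p. \<forall>A \<in> carrier_mat m m. \<forall>X \<in> carrier_mat m p. skew_hermitian_mat (A :: real mat) \<longrightarrow>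
         skew_hermitian_mat (wedderburn_R A X)) \<and>
      (\<forall>m p. \<forall>A \<in> carrier_mat m m. \<forall>X \<in> carrier_mat m p. skew_hermitian_mat (A :: complex mat) \<longrightarrow>
         skew_hermitian_mat (wedderburn_R A X))) \<and>
    \<comment> \<open>(iii)\<close>
     (let A = (1 / sqrt 6) \<cdot>\<^sub>m mat_of_rows_list 3
                [[sqrt 3, 0, sqrt 3], [- sqrt 2, sqrt 2, sqrt 2], [1, 2, - 1]];
          X = mat_of_rows_list 1 [[1], [0], [1]];
          B = (1 / sqrt 6) \<cdot>\<^sub>m mat_of_rows_list 3
                [[- 1, - 2, 1], [- sqrt 2, sqrt 2, sqrt 2], [1, 2, - 1]];
          A' = map_mat complex_of_real A;
          X' = map_mat complex_of_real X;
          B' = map_mat complex_of_real B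
      in normal_mat A \<and> wedderburn_R A X = B \<and>
           commutator_mat B (mat_adjoint B) \<noteq> 0\<^sub>m 3 3 \<and> \<not> normal_mat B \<and>
         normal_mat A' \<and> wedderburn_R A' X' = B' \<and>
           commutator_mat B' (mat_adjoint B') \<noteq> 0\<^sub>m 3 3 \<and> \<not> normal_mat B' \<and>
         \<not> diagonalizable_mat A \<and> diagonalizable_mat B) \<and>
    \<comment> \<open>(iv)\<close>
     (\<exists>m p. \<exists>A \<in> carrier_mat m m. \<exists>X \<in> carrier_mat m p.
        diagonalizable_mat (A :: real mat) \<and> \<not> diagonalizable_mat (wedderburn_R A X)) \<and>
    \<comment> \<open>(v)\<close>
     (let A = mat_of_rows_list 4 [[0, 1, 0, 0], [0, 0, 1, 0], [0, 0, 0, 1], [0, 0, 0, 0]];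
          X = mat_of_rows_list 1 [[1], [1], [1], [0]];
          N = (1 / 2 :: real) \<cdot>\<^sub>m mat_of_rows_list 4
                [[0, 1, - 1, - 1], [0, - 1, 1, - 1], [0, 0, 0, 2], [0, 0, 0, 0]];
          A' = map_mat complex_of_real A;
          X' = map_mat complex_of_real X;
          N' = map_mat complex_of_real N
      in nilpotent_mat A \<and> wedderburn_R A X = N \<and> \<not> nilpotent_mat N \<and>
         nilpotent_mat A' \<and> wedderburn_R A' X' = N' \<and> \<not> nilpotent_mat N')"
proof -
  let ?A = normal_example and ?X = normal_column and ?B = normal_reduced
  have iii: "normal_mat ?A \<and> wedderburn_R ?A ?X = ?B \<and>
      commutator_mat ?B (mat_adjoint ?B) \<noteq> 0\<^sub>m 3 3 \<and> \<not> normal_mat ?B \<and>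
      normal_mat (cmat ?A) \<and> wedderburn_R (cmat ?A) (cmat ?X) = cmat ?B \<and>
      commutator_mat (cmat ?B) (mat_adjoint (cmat ?B)) \<noteq> 0\<^sub>m 3 3 \<and> \<not> normal_mat (cmat ?B) \<and>
      \<not> diagonalizable_mat ?A \<and> diagonalizable_mat ?B"
  proof -
    note c = normal_carrier
    have "normal_mat ?A" by (simp add: normal_mat_def orthogonal_normal_example)
    moreover have "cmat ?B \<in> carrier_mat 3 3" using c by simp
    ultimately show ?thesis
      using wedderburn_R_normal_example not_normal_normal_reduced not_diagonalizable_normal_example
        diagonalizable_normal_reduced
      by (simp add: commutator_adjoint_eq_zero_iff[OF c(3)] commutator_adjoint_eq_zero_iff[of "cmat ?B" 3]
          normal_mat_cmat[OF c(1)] normal_mat_cmat[OF c(3)] wedderburn_R_cmat[OF c(1,2)])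
  qed
  let ?A = nilpotent_example and ?X = nilpotent_column and ?N = nilpotent_reduced
  have v: "nilpotent_mat ?A \<and> wedderburn_R ?A ?X = ?N \<and> \<not> nilpotent_mat ?N \<and>
      nilpotent_mat (cmat ?A) \<and> wedderburn_R (cmat ?A) (cmat ?X) = cmat ?N \<and> \<not> nilpotent_mat (cmat ?N)"
    using nilpotent_mat_example wedderburn_R_nilpotent_example not_nilpotent_reduced
    by (simp add: nilpotent_mat_cmat[OF nilpotent_carrier(1)] nilpotent_mat_cmat[OF nilpotent_carrier(3)]
        wedderburn_R_cmat[OF nilpotent_carrier(1,2)])
  show ?thesis
  proof (rule conjI[OF _ conjI[OF _ conjI[OF _ conjI]]], goal_cases)
    case 1
    show ?case
      by (rule conjI; intro allI ballI impI; rule semidefinite_reduction; assumption)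
  next
    case 2
    show ?case
      by (rule conjI; intro allI ballI impI; rule skew_hermitian_wedderburn_R; assumption)
  next
    case 3
    show ?case
      using iii unfolding normal_example_def normal_column_def normal_reduced_def Let_def .
  next
    case 4
    show ?case by (rule diagonalizable_with_defective_reduction)
  next
    case 5
    show ?case
      using v unfolding nilpotent_example_def nilpotent_column_def nilpotent_reduced_def Let_def .
  qed
qed

end
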